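(* Let $A\in\mathbb{C}^{n\times n}$ have index $k$ and satisfy $\operatorname{rank}(A^{\sim}AA^{\sim})=\operatorname{rank}(A)$. Then the system of matrix equations $$XAX=X,\qquad XA=A^{D}A,\qquad A^{k}X=A^{k}A^{\mathfrak{m}}$$ in the unknown $X\in\mathbb{C}^{n\times n}$ has the unique solution $X=A^{D}AA^{\mathfrak{m}}$.
   Context: The index of $A\in\mathbb{C}^{n\times n}$ is the smallest nonnegative integer $k$ with $\operatorname{rank}(A^{k+1})=\operatorname{rank}(A^{k})$. The Minkowski metric matrix of order $n$ is $G=\operatorname{diag}(1,-I_{n-1})$. For $A\in\mathbb{C}^{n\times n}$, the Minkowski adjoint is $A^{\sim}=GA^{*}G$, where $A^*$ is the conjugate transpose. The Drazin inverse $A^{D}$ of $A$ (of index $k$) is the unique $X$ with $XAX=X$, $AX=XA$, $A^{k+1}X=A^{k}$. The Minkowski inverse $A^{\mathfrak{m}}$ is the unique matrix $X$ (if it exists) with $AXA=A$, $XAX=X$, $(AX)^{\sim}=AX$, $(XA)^{\sim}=XA$; it exists if and only if $\operatorname{rank}(A^{\sim}AA^{\sim})=\operatorname{rank}(A)$. *)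

theory Defs
  imports
    "Jordan_Normal_Form.DL_Rank"
    "Jordan_Normal_Form.Schur_Decomposition"
begin

text \<open>An element of \<open>carrier_mat n n\<close> is an $n \times n$ matrix with rows and columns indexed by
  \<open>0, \<dots>, n - 1\<close>. The definitions below are meant for square matrices and read off the order
  as \<open>dim_row A\<close>.\<close>

definition mat_rank :: "complex mat \<Rightarrow> nat" where
  "mat_rank A = vec_space.rank (dim_row A) A"

definition mat_index :: "complex mat \<Rightarrow> nat" where
  "mat_index A = (LEAST k. mat_rank (A ^\<^sub>m (k + 1)) = mat_rank (A ^\<^sub>m k))"

definition minkowski_metric :: "nat \<Rightarrow> complex mat" where
  "minkowski_metric n = mat n n (\<lambda>(i, j). if i = j then (if i = 0 then 1 else - 1) else 0)"

definition minkowski_adjoint :: "complex mat \<Rightarrow> complex mat" where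
  "minkowski_adjoint A =
     minkowski_metric (dim_row A) * mat_adjoint A * minkowski_metric (dim_row A)"

definition is_drazin_inverse :: "complex mat \<Rightarrow> complex mat \<Rightarrow> bool" where
  "is_drazin_inverse A X \<longleftrightarrow>
     X \<in> carrier_mat (dim_row A) (dim_row A) \<and>
     X * A * X = X \<and>
     A * X = X * A \<and>
     A ^\<^sub>m (mat_index A + 1) * X = A ^\<^sub>m mat_index A"

definition drazin_inverse :: "complex mat \<Rightarrow> complex mat" where
  "drazin_inverse A = (THE X. is_drazin_inverse A X)"

definition is_minkowski_inverse :: "complex mat \<Rightarrow> complex mat \<Rightarrow> bool" where
  "is_minkowski_inverse A X \<longleftrightarrow>
     X \<in> carrier_mat (dim_row A) (dim_row A) \<and>
     A * X * A = A \<and>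
     X * A * X = X \<and>
     minkowski_adjoint (A * X) = A * X \<and>
     minkowski_adjoint (X * A) = X * A"

text \<open>If no Minkowski inverse exists, the value of \<open>minkowski_inverse A\<close> is unspecified.\<close>

definition minkowski_inverse :: "complex mat \<Rightarrow> complex mat" where
  "minkowski_inverse A = (THE X. is_minkowski_inverse A X)"

end

theory Submission
  imports Defs
begin

text \<open>
  Write $D$ for the Drazin inverse and $M$ for the Minkowski inverse of $A$. Once both are known to
  exist, the theorem is a short computation. That $X = DAM$ solves the system follows from
  $AMA = A$, $DAD = D$, $AD = DA$ and $A^{k+1}D = A^k$. Conversely, any solution satisfies
  $X = XAX = DAX$, so it is determined by $DX$; since $D = D^{k+1}A^k$, the product $DX$ depends
  only on $A^kX$, which is prescribed to be $A^kM$.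

  The real content is the existence of $D$ and $M$, where the rank hypotheses enter. They are turned
  into identities between matrices by one principle: if $BC$ has the same rank as one of its factors,
  then that factor can be recovered from $BC$, that is $B = BCY$ or $C = ZBC$ for suitable $Y$, $Z$
  (\<open>left_factor_recoverable\<close>, \<open>right_factor_recoverable\<close>). Both forms follow from a full-rank
  factorization $A = PQ$ with a left inverse of $P$ and a right inverse of $Q$
  (\<open>rank_factorization\<close>).

  For the Drazin inverse, equality of the ranks of $A^{k+1}$ and $A^k$ gives
  $A^k = A^{k+1}Y = ZA^{k+1}$, and $A^kY^{k+1}$ is then the inverse, by an argument valid in every
  monoid (\<open>drazin_inverse_exists\<close>). The Minkowski inverse is the Moore--Penrose inverse for the
  involution $A \mapsto A^\sim$. The rank hypothesis gives $A = AA^\sim Y = ZA^\sim A$, and in any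
  monoid with an involution these two identities provide the inverse
  (\<open>moore_penrose_inverse_exists\<close>).
\<close>

section \<open>Full-rank factorization and recovery of factors\<close>

text \<open>The Gram matrix $P^*P$ is invertible: if $P^*Pv = 0$ then $\|Pv\|^2 = v^*P^*Pv = 0$. Hence
  $(P^*P)^{-1}P^*$ is a left inverse.\<close>

lemma injective_imp_left_inverse:
  fixes P :: "complex mat"
  assumes P: "P \<in> carrier_mat n r"
    and inj: "\<And>v. v \<in> carrier_vec r \<Longrightarrow> P *\<^sub>v v = 0\<^sub>v n \<Longrightarrow> v = 0\<^sub>v r"
  obtains L where "L \<in> carrier_mat r n" "L * P = 1\<^sub>m r"
proof -
  let ?C = "map_mat conjugate P"
  let ?B = "?C\<^sup>T * P"
  have C: "?C \<in> carrier_mat n r" and B: "?B \<in> carrier_mat r r" using P by auto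
  have "det ?B \<noteq> 0"
  proof
    assume "det ?B = 0"
    then obtain v where v: "v \<in> carrier_vec r" "v \<noteq> 0\<^sub>v r" "?B *\<^sub>v v = 0\<^sub>v r"
      using det_0_iff_vec_prod_zero_field[OF B] by blast
    define w where "w = P *\<^sub>v v"
    have w: "w \<in> carrier_vec n" using P v(1) by (simp add: w_def)
    have conj_w: "conjugate w = ?C *\<^sub>v conjugate v"
      using P v(1) by (intro eq_vecI) (auto simp: w_def scalar_prod_def sum_conjugate conjugate_dist_mul)
    have "?C\<^sup>T *\<^sub>v w = 0\<^sub>v r"
      using v(3) P v(1) C by (simp add: w_def assoc_mult_mat_vec[of _ r n _ r])
    then have "w \<bullet>c w = 0"
      using transpose_vec_mult_scalar[OF C, of "conjugate v" w] v(1) w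
      by (simp add: conj_w comm_scalar_prod[of w n] C) 
    then have "w = 0\<^sub>v n" using conjugate_square_eq_0_vec[OF w] by simp
    then show False using inj[OF v(1)] v(2) by (simp add: w_def)
  qed
  from det_non_zero_imp_unit[OF B this]
  obtain X where X: "X \<in> carrier_mat r r" "X * ?B = 1\<^sub>m r"
    unfolding Units_def by (auto simp: ring_mat_simps)
  have "(X * ?C\<^sup>T) * P = 1\<^sub>m r" using X P C by (simp add: assoc_mult_mat[of _ r r _ n _ r])
  then show thesis using that[of "X * ?C\<^sup>T"] X C by auto
qed

lemma rank_mult_le_left:
  fixes A :: "'a :: field mat"
  assumes A: "A \<in> carrier_mat n m" and B: "B \<in> carrier_mat m p"
  shows "vec_space.rank n (A * B) \<le> vec_space.rank n A"
proof -
  interpret vec_space "TYPE('a)" n .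
  have AB: "A * B \<in> carrier_mat n p" using A B by simp
  have cA: "set (cols A) \<subseteq> carrier_vec n" and cAB: "set (cols (A * B)) \<subseteq> carrier_vec n"
    using cols_dim A AB by (metis carrier_matD(1))+
  have "set (cols (A * B)) \<subseteq> span (set (cols A))"
  proof
    fix x assume "x \<in> set (cols (A * B))"
    then obtain j where "j < p" "x = col (A * B) j"
      using AB by (auto simp: cols_def)
    then have "x = A *\<^sub>v col B j" by (simp only: col_mult2[OF A B])
    moreover have "col B j \<in> carrier_vec m" using B by auto
    ultimately have "x \<in> col_space A" using A by (auto simp: col_space_eq[OF A])
    then show "x \<in> span (set (cols A))" by (simp add: col_space_def)
  qed
  then have le: "span (set (cols (A * B))) \<subseteq> span (set (cols A))"
    by (rule span_subsetI[OF cA])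
  have sA: "VectorSpace.subspace class_ring (span (set (cols A))) V"
    and sAB: "VectorSpace.subspace class_ring (span (set (cols (A * B)))) V"
    using span_is_subspace cA cAB by auto
  show ?thesis unfolding rank_def
    using vectorspace.subspace_dim[OF subspace_is_vs[OF sA] nested_subspaces[OF sA sAB le]]
      fin_dim_span_cols[OF A] fin_dim_span_cols[OF AB] by simp
qed

text \<open>The columns of $P$ form a maximal independent set of columns of $A$, so $P$ is injective and has a
  left inverse, and every column of $A$ is a combination of columns of $P$; the coefficients are
  collected in $Q$. The matrix $R$ selects the chosen columns, $AR = P$; thus $PQR = P$, and
  cancelling $P$ gives $QR = 1$.\<close>

lemma rank_factorization:
  fixes A :: "complex mat"
  assumes A: "A \<in> carrier_mat n m"
  defines "r \<equiv> vec_space.rank n A"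
  obtains P Q L R where "P \<in> carrier_mat n r" "Q \<in> carrier_mat r m" "A = P * Q"
    "L \<in> carrier_mat r n" "L * P = 1\<^sub>m r" "R \<in> carrier_mat m r" "Q * R = 1\<^sub>m r"
proof -
  interpret vec_space "TYPE(complex)" n .
  have cA: "set (cols A) \<subseteq> carrier_vec n" using cols_dim A by (metis carrier_matD(1))
  have li0: "lin_indpt {}"
    by (metis (no_types) empty_subsetI fin_dim finite_basis_exists subset_li_is_li vec_vs vectorspace.basis_def)
  obtain S where S: "maximal S (\<lambda>T. T \<subseteq> set (cols A) \<and> lin_indpt T)"
    using maximal_exists_superset[of "set (cols A)" "\<lambda>T. T \<subseteq> set (cols A) \<and> lin_indpt T" "{}"] li0 by auto
  then have SA: "S \<subseteq> set (cols A)" and liS: "lin_indpt S" by (auto simp: maximal_def)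
  have finS: "finite S" using SA finite_subset by blast
  have cS: "S \<subseteq> carrier_vec n" using SA cA by auto
  have r: "r = card S" unfolding r_def by (rule rank_card_indpt[OF A S])
  obtain ss where ss: "set ss = S" "distinct ss" using finite_distinct_list[OF finS] by auto
  have len: "length ss = r" using ss r distinct_card by fastforce
  define P where "P = mat_of_cols n ss"
  have P: "P \<in> carrier_mat n r" and colsP: "cols P = ss" using ss cS len by (auto simp: P_def)
  have injP: "v = 0\<^sub>v r" if "v \<in> carrier_vec r" "P *\<^sub>v v = 0\<^sub>v n" for v
    using lin_depI[OF P that(1) _ that(2)] liS ss colsP by auto
  obtain L where L: "L \<in> carrier_mat r n" "L * P = 1\<^sub>m r"
    using injective_imp_left_inverse[OF P injP] by blast
  have "x \<in> span S" if x: "x \<in> set (cols A)" for x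
  proof (rule ccontr)
    assume nx: "x \<notin> span S"
    then have xS: "x \<notin> S" using in_own_span[of S] cS by auto
    have "lin_indpt (S \<union> {x})" using lin_dep_iff_in_span[of S x] cS liS nx xS x cA by auto
    then show False using S x xS SA unfolding maximal_def by blast
  qed
  then have "\<exists>c \<in> carrier_vec r. P *\<^sub>v c = col A j" if "j < m" for j
  proof -
    have "col A j \<in> set (cols A)" using that A by (auto simp: cols_def)
    with \<open>\<And>x. x \<in> set (cols A) \<Longrightarrow> x \<in> span S\<close> have "col A j \<in> col_space P"
      by (simp add: col_space_def colsP ss)
    then show ?thesis using col_space_eq[OF P] P by auto
  qed
  then obtain c where c: "\<And>j. j < m \<Longrightarrow> c j \<in> carrier_vec r" "\<And>j. j < m \<Longrightarrow> P *\<^sub>v c j = col A j" by metis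
  define Q where "Q = mat_of_cols r (map c [0..<m])"
  have Q: "Q \<in> carrier_mat r m" by (simp add: Q_def mat_of_cols_def)
  have colQ: "col Q j = c j" if "j < m" for j using that c(1) by (simp add: Q_def)
  have APQ: "A = P * Q"
  proof (rule mat_col_eqI)
    fix j assume "j < dim_col (P * Q)"
    then have "j < m" using Q by simp
    then show "col A j = col (P * Q) j" by (simp only: col_mult2[OF P Q] colQ c(2))
  qed (use A P Q in auto)
  have "\<exists>j<m. ss ! i = col A j" if "i < r" for i
  proof -
    have "ss ! i \<in> set (cols A)" using that len ss SA nth_mem by blast
    then show ?thesis using A by (auto simp: cols_def)
  qed
  then obtain f where f: "\<And>i. i < r \<Longrightarrow> f i < m" "\<And>i. i < r \<Longrightarrow> ss ! i = col A (f i)" by metis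
  \<comment> \<open>Column \<open>i\<close> of \<open>P\<close> is column \<open>f i\<close> of \<open>A\<close>.\<close>
  define R where "R = mat_of_cols m (map (\<lambda>i. unit_vec m (f i) :: complex vec) [0..<r])"
  have R: "R \<in> carrier_mat m r" by (simp add: R_def mat_of_cols_def)
  have "A * R = P"
  proof (rule mat_col_eqI)
    fix i assume "i < dim_col P"
    then have i: "i < r" using P by simp
    then have "col (A * R) i = A *\<^sub>v unit_vec m (f i)"
      by (simp only: col_mult2[OF A R]) (simp add: R_def)
    also have "\<dots> = col A (f i)" using f(1)[OF i] A by (auto intro!: eq_vecI)
    also have "\<dots> = col P i" using f(2)[OF i] i len ss(1) cS nth_mem[of i ss] by (simp add: P_def subset_iff)
    finally show "col (A * R) i = col P i" .
  qed (use A R P in auto)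
  then have PQR: "P * (Q * R) = P" using APQ P Q R by (simp add: assoc_mult_mat[of _ n r _ m _ r])
  have "Q * R = (L * P) * (Q * R)" using L Q R by simp
  also have "\<dots> = L * (P * (Q * R))" using L(1) P Q R by (intro assoc_mult_mat) auto
  also have "\<dots> = 1\<^sub>m r" by (simp add: PQR L)
  finally have "Q * R = 1\<^sub>m r" .
  with that P Q APQ L R show thesis by blast
qed

lemma rank_mult_le_right:
  fixes A B :: "complex mat"
  assumes A: "A \<in> carrier_mat n m" and B: "B \<in> carrier_mat m p"
  shows "vec_space.rank n (A * B) \<le> vec_space.rank m B"
proof -
  define r where "r = vec_space.rank m B"
  obtain P Q where PQ: "P \<in> carrier_mat m r" "Q \<in> carrier_mat r p" "B = P * Q"
    using rank_factorization[OF B] unfolding r_def by metis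
  have AP: "A * P \<in> carrier_mat n r" using A PQ by simp
  have "vec_space.rank n (A * B) = vec_space.rank n ((A * P) * Q)"
    using A PQ by (simp add: assoc_mult_mat[of _ n m _ r _ p])
  also have "\<dots> \<le> vec_space.rank n (A * P)" by (rule rank_mult_le_left[OF AP PQ(2)])
  also have "\<dots> \<le> r" by (rule vec_space.rank_le_nc[OF AP])
  finally show ?thesis by (simp add: r_def)
qed

text \<open>The column space of $BC$ is then all of the column space of $B$. In terms of a factorization
  $B = PQ$: the matrix $QC$ has as many rows as its rank, so it has a right inverse $W$, and
  $BCWQ = P(QCW)Q = B$.\<close>

lemma left_factor_recoverable:
  fixes B C :: "complex mat"
  assumes B: "B \<in> carrier_mat n m" and C: "C \<in> carrier_mat m p"
    and eq: "vec_space.rank n (B * C) = vec_space.rank n B"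
  obtains Y where "Y \<in> carrier_mat p m" "B = B * C * Y"
proof -
  define r where "r = vec_space.rank n B"
  obtain P Q where PQ: "P \<in> carrier_mat n r" "Q \<in> carrier_mat r m" "B = P * Q"
    using rank_factorization[OF B] unfolding r_def by metis
  have QC: "Q * C \<in> carrier_mat r p" using PQ C by simp
  have BC: "B * C = P * (Q * C)" using PQ C by (simp add: assoc_mult_mat[of _ n r _ m _ p])
  have "r \<le> vec_space.rank r (Q * C)"
    using rank_mult_le_right[OF PQ(1) QC] eq by (simp add: BC r_def)
  then have rk: "vec_space.rank r (Q * C) = r"
    using rank_mult_le_left[OF one_carrier_mat QC] vec_space.rank_le_nc[of "1\<^sub>m r :: complex mat" r r]
    unfolding left_mult_one_mat[OF QC] by simp
  obtain P' Q' L' R' where F: "P' \<in> carrier_mat r r" "Q' \<in> carrier_mat r p" "Q * C = P' * Q'"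
    "L' \<in> carrier_mat r r" "L' * P' = 1\<^sub>m r" "R' \<in> carrier_mat p r" "Q' * R' = 1\<^sub>m r"
    using rank_factorization[OF QC] unfolding rk by metis
  \<comment> \<open>A square matrix with a left inverse is invertible, so \<open>R' * L'\<close> inverts \<open>Q * C = P' * Q'\<close>
    from the right.\<close>
  have PL: "P' * L' = 1\<^sub>m r" using mat_mult_left_right_inverse[OF F(4,1,5)] .
  have "Q * C * (R' * L') = P' * ((Q' * R') * L')"
    using F(1,2,4,6) unfolding F(3) by (simp add: assoc_mult_mat[of _ r p _ r _ r] assoc_mult_mat[of _ r r _ p _ r])
  then have inv: "Q * C * (R' * L') = 1\<^sub>m r" using F PL by simp
  have RL: "R' * L' \<in> carrier_mat p r" using F by simp
  have "B * C * (R' * L' * Q) = P * ((Q * C * (R' * L')) * Q)"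
    unfolding BC using PQ QC RL
    by (simp add: assoc_mult_mat[of _ n r _ p _ m] assoc_mult_mat[of _ r p _ r _ m])
  then have "B = B * C * (R' * L' * Q)" using inv PQ by simp
  then show thesis using that[of "R' * L' * Q"] RL PQ by auto
qed

text \<open>The kernel of $BC$ is then no larger than the kernel of $C$. In terms of a factorization
  $C = PQ$: the matrix $BP$ has as many columns as its rank, so it has a left inverse $W$, and
  $PW(BC) = P(WBP)Q = C$.\<close>

lemma right_factor_recoverable:
  fixes B C :: "complex mat"
  assumes B: "B \<in> carrier_mat n m" and C: "C \<in> carrier_mat m p"
    and eq: "vec_space.rank n (B * C) = vec_space.rank m C"
  obtains Z where "Z \<in> carrier_mat m n" "C = Z * (B * C)"
proof -
  define r where "r = vec_space.rank m C"
  obtain P Q where PQ: "P \<in> carrier_mat m r" "Q \<in> carrier_mat r p" "C = P * Q"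
    using rank_factorization[OF C] unfolding r_def by metis
  have BP: "B * P \<in> carrier_mat n r" using PQ B by simp
  have BC: "B * C = (B * P) * Q" using PQ B by (simp add: assoc_mult_mat[of _ n m _ r _ p])
  have rk: "vec_space.rank n (B * P) = r"
    using rank_mult_le_left[OF BP PQ(2)] eq vec_space.rank_le_nc[OF BP] by (simp add: BC r_def)
  obtain P' Q' L' R' where F: "P' \<in> carrier_mat n r" "Q' \<in> carrier_mat r r" "B * P = P' * Q'"
    "L' \<in> carrier_mat r n" "L' * P' = 1\<^sub>m r" "R' \<in> carrier_mat r r" "Q' * R' = 1\<^sub>m r"
    using rank_factorization[OF BP] unfolding rk by metis
  \<comment> \<open>Now the square factor is \<open>Q'\<close>, and \<open>R' * L'\<close> inverts \<open>B * P = P' * Q'\<close> from the left.\<close>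
  have RQ: "R' * Q' = 1\<^sub>m r" using mat_mult_left_right_inverse[OF F(2,6,7)] .
  have "R' * L' * (B * P) = R' * ((L' * P') * Q')"
    using F(1,2,4,6) unfolding F(3) by (simp add: assoc_mult_mat[of _ r n _ r _ r] assoc_mult_mat[of _ r r _ n _ r])
  then have inv: "R' * L' * (B * P) = 1\<^sub>m r" using F RQ by simp
  have RL: "R' * L' \<in> carrier_mat r n" using F by simp
  have "P * (R' * L') * (B * C) = P * ((R' * L' * (B * P)) * Q)"
    unfolding BC using PQ BP RL
    by (simp add: assoc_mult_mat[of _ m r _ n _ p] assoc_mult_mat[of _ r n _ r _ p])
  then have "C = P * (R' * L') * (B * C)" using inv PQ by simp
  then show thesis using that[of "P * (R' * L')"] RL PQ by auto
qed

section \<open>Drazin inverses in a monoid\<close>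

context monoid
begin

text \<open>The hypotheses give $a^k y = z a^{k+1} y = z a^k$ and therefore
  $a^k y^j = z^j a^k$ for all $j$. The element $x = a^k y^{k+1} = z^{k+1} a^k$ thus has a
  description from either side, and $ax = a^k y^k = z^k a^k = xa$; the remaining equations come from
  absorbing powers of $y$ or $z$ into powers of $a$.\<close>

lemma drazin_inverse_exists:
  fixes k :: nat
  assumes [simp]: "a \<in> carrier G" "y \<in> carrier G" "z \<in> carrier G"
    and y: "a [^] k = a [^] (k + 1) \<otimes> y" and z: "a [^] k = z \<otimes> a [^] (k + 1)"
  shows "\<exists>x \<in> carrier G. x \<otimes> a \<otimes> x = x \<and> a \<otimes> x = x \<otimes> a \<and> a [^] (k + 1) \<otimes> x = a [^] k"
proof -
  have yz: "a [^] k \<otimes> y = z \<otimes> a [^] k"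
  proof -
    have "a [^] k \<otimes> y = z \<otimes> (a [^] (k + 1) \<otimes> y)"
      by (subst z) (simp only: m_assoc nat_pow_closed assms(1-3))
    then show ?thesis by (simp only: y[symmetric])
  qed
  have swap: "a [^] k \<otimes> y [^] j = z [^] j \<otimes> a [^] k" for j :: nat
  proof (induction j)
    case (Suc j)
    have "a [^] k \<otimes> y [^] Suc j = (a [^] k \<otimes> y [^] j) \<otimes> y" by (simp add: m_assoc)
    also have "\<dots> = z [^] j \<otimes> (a [^] k \<otimes> y)" by (simp add: Suc m_assoc)
    also have "\<dots> = z [^] Suc j \<otimes> a [^] k" by (simp add: yz m_assoc)
    finally show ?case .
  qed simp
  have absorb_right: "a [^] (j + k) \<otimes> y [^] j = a [^] k" for j :: nat
  proof (induction j)
    case (Suc j)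
    have "a [^] (Suc j + k) = a [^] j \<otimes> a [^] (k + 1)"
      using nat_pow_mult[of a j "k + 1"] by (simp del: nat_pow_Suc)
    then have "a [^] (Suc j + k) \<otimes> y [^] Suc j = a [^] j \<otimes> (a [^] (k + 1) \<otimes> y) \<otimes> y [^] j"
      by (simp only: nat_pow_Suc2 m_assoc nat_pow_closed m_closed assms(1,2))
    also have "\<dots> = a [^] (j + k) \<otimes> y [^] j" by (simp only: y[symmetric] nat_pow_mult assms(1))
    finally show ?case using Suc by simp
  qed simp
  have absorb_left: "z [^] j \<otimes> a [^] (k + j) = a [^] k" for j :: nat
  proof (induction j)
    case (Suc j)
    have "a [^] (k + Suc j) = a [^] (k + 1) \<otimes> a [^] j"
      using nat_pow_mult[of a "k + 1" j] by (simp del: nat_pow_Suc)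
    then have "z [^] Suc j \<otimes> a [^] (k + Suc j) = z [^] j \<otimes> ((z \<otimes> a [^] (k + 1)) \<otimes> a [^] j)"
      by (simp only: nat_pow_Suc m_assoc nat_pow_closed m_closed assms(1,3))
    also have "\<dots> = z [^] j \<otimes> a [^] (k + j)" by (simp only: z[symmetric] nat_pow_mult assms(1))
    finally show ?case using Suc by simp
  qed simp
  define x where "x = a [^] k \<otimes> y [^] (k + 1)"
  have [simp]: "x \<in> carrier G" by (simp add: x_def)
  have ax: "a \<otimes> x = a [^] k \<otimes> y [^] k"
  proof -
    have "a \<otimes> x = (a \<otimes> a [^] k) \<otimes> (y \<otimes> y [^] k)"
      unfolding x_def using nat_pow_Suc2[of y k] by (simp add: m_assoc del: nat_pow_Suc)
    also have "a \<otimes> a [^] k = a [^] (k + 1)" using nat_pow_Suc2[of a k] by simp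
    also have "a [^] (k + 1) \<otimes> (y \<otimes> y [^] k) = (a [^] (k + 1) \<otimes> y) \<otimes> y [^] k"
      by (simp add: m_assoc del: nat_pow_Suc)
    finally show ?thesis by (simp only: y[symmetric])
  qed
  have xa: "x \<otimes> a = a [^] k \<otimes> y [^] k"
  proof -
    have "x \<otimes> a = z [^] k \<otimes> (z \<otimes> a [^] (k + 1))"
      unfolding x_def swap by (simp add: m_assoc)
    then show ?thesis by (simp only: z[symmetric] swap)
  qed
  have "x \<otimes> a \<otimes> x = a [^] k \<otimes> y [^] k \<otimes> a [^] k \<otimes> y [^] (k + 1)"
    unfolding xa by (simp add: x_def m_assoc)
  also have "\<dots> = (z [^] k \<otimes> a [^] (k + k)) \<otimes> y [^] (k + 1)"
    by (simp only: swap nat_pow_mult[symmetric] m_assoc nat_pow_closed m_closed assms(1-3))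
  also have "\<dots> = x" by (simp only: absorb_left x_def)
  finally have xax: "x \<otimes> a \<otimes> x = x" .
  have "a [^] (k + 1) \<otimes> x = a [^] k \<otimes> (a \<otimes> x)" by (simp add: m_assoc)
  also have "\<dots> = a [^] (k + k) \<otimes> y [^] k" by (simp only: ax m_assoc nat_pow_mult[symmetric] nat_pow_closed assms(1-3))
  also have "\<dots> = a [^] k" by (rule absorb_right)
  finally show ?thesis using xax ax xa by (intro bexI[of _ x]) auto
qed

text \<open>Because $xa = ax$ is idempotent with $xax = x$, inserting further factors $xa$ does not change
  $x$. This is how a Drazin inverse absorbs the power $a^k$ that occurs in its defining equations.\<close>

lemma commuting_outer_inverse_power:
  fixes k :: nat
  assumes [simp]: "a \<in> carrier G" "x \<in> carrier G" and xax: "x \<otimes> a \<otimes> x = x" and com: "a \<otimes> x = x \<otimes> a"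
  shows "x [^] (k + 1) \<otimes> a [^] k = x"  "a [^] k \<otimes> x [^] (k + 1) = x"
proof -
  have "x [^] (k + 1) \<otimes> a [^] k = x"
  proof (induction k)
    case (Suc k)
    have "x [^] (Suc k + 1) = x \<otimes> x [^] (k + 1)" using nat_pow_Suc2[of x "Suc k"] by simp
    then have "x [^] (Suc k + 1) \<otimes> a [^] Suc k = x \<otimes> (x [^] (k + 1) \<otimes> a [^] k) \<otimes> a"
      by (simp only: nat_pow_Suc m_assoc nat_pow_closed m_closed assms(1,2))
    also have "\<dots> = x \<otimes> a \<otimes> x" by (simp only: Suc m_assoc com assms(1,2))
    finally show ?case by (simp only: xax)
  qed simp
  moreover have "x [^] (k + 1) \<otimes> a [^] k = a [^] k \<otimes> x [^] (k + 1)"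
    by (metis com assms(1,2) group_commutes_pow nat_pow_closed)
  ultimately show "x [^] (k + 1) \<otimes> a [^] k = x"  "a [^] k \<otimes> x [^] (k + 1) = x" by auto
qed

text \<open>Both elements equal $xay$: write $x = x^{k+1}a^k$ and replace $a^k$ by $a^{k+1}y$, and write
  $y = a^k y^{k+1}$ and replace $a^k$ by $xa^{k+1}$.\<close>

lemma drazin_inverse_unique:
  fixes k :: nat
  assumes [simp]: "a \<in> carrier G" "x \<in> carrier G" "y \<in> carrier G"
    and x: "x \<otimes> a \<otimes> x = x" "a \<otimes> x = x \<otimes> a" "a [^] (k + 1) \<otimes> x = a [^] k"
    and y: "y \<otimes> a \<otimes> y = y" "a \<otimes> y = y \<otimes> a" "a [^] (k + 1) \<otimes> y = a [^] k"
  shows "x = y"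
proof -
  have "x = x [^] (k + 1) \<otimes> (a [^] k \<otimes> a \<otimes> y)"
    using commuting_outer_inverse_power(1)[OF _ _ x(1,2), of k] y(3) by simp
  also have "\<dots> = (x [^] (k + 1) \<otimes> a [^] k) \<otimes> a \<otimes> y"
    by (simp add: m_assoc del: nat_pow_Suc)
  also have "\<dots> = x \<otimes> a \<otimes> y" using commuting_outer_inverse_power(1)[OF _ _ x(1,2), of k] by simp
  finally have 1: "x = x \<otimes> a \<otimes> y" .
  have xak: "x \<otimes> a [^] (k + 1) = a [^] k"
    using x(2,3) group_commutes_pow[of a x "k + 1"] by simp
  have "y = a [^] k \<otimes> y [^] (k + 1)"
    using commuting_outer_inverse_power(2)[OF _ _ y(1,2), of k] by simp
  also have "\<dots> = x \<otimes> a \<otimes> (a [^] k \<otimes> y [^] (k + 1))"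
    using nat_pow_Suc2[of a k] by (subst xak[symmetric]) (simp add: m_assoc del: nat_pow_Suc)
  also have "\<dots> = x \<otimes> a \<otimes> y"
    using commuting_outer_inverse_power(2)[OF _ _ y(1,2), of k] by simp
  finally show ?thesis using 1 by simp
qed

end

section \<open>Moore--Penrose inverses in a monoid with involution\<close>

locale involutive_monoid = monoid G for G (structure) +
  fixes star :: "'a \<Rightarrow> 'a"
  assumes star_closed [simp]: "a \<in> carrier G \<Longrightarrow> star a \<in> carrier G"
    and star_mult: "a \<in> carrier G \<Longrightarrow> b \<in> carrier G \<Longrightarrow> star (a \<otimes> b) = star b \<otimes> star a"
    and star_star [simp]: "a \<in> carrier G \<Longrightarrow> star (star a) = a"
begin

text \<open>From $a = aa^*y$ the element $y^*a = y^*aa^*y$ is self-adjoint and $a\,y^*\,a = a$; from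
  $a = za^*a$ the element $az^* = za^*az^*$ is self-adjoint and $a\,z^*\,a = a$. So $y^*$ and $z^*$
  are inner inverses of $a$, each with one of the two symmetries, and the product $y^*az^*$ has
  both.\<close>

lemma moore_penrose_inverse_exists:
  assumes [simp]: "a \<in> carrier G" "y \<in> carrier G" "z \<in> carrier G"
    and y: "a = a \<otimes> star a \<otimes> y" and z: "a = z \<otimes> star a \<otimes> a"
  shows "\<exists>m \<in> carrier G. a \<otimes> m \<otimes> a = a \<and> m \<otimes> a \<otimes> m = m \<and>
    star (a \<otimes> m) = a \<otimes> m \<and> star (m \<otimes> a) = m \<otimes> a"
proof -
  have sy: "star a = star y \<otimes> a \<otimes> star a"
    using arg_cong[OF y, of star] by (simp add: star_mult m_assoc)
  have sz: "star a = star a \<otimes> a \<otimes> star z"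
    using arg_cong[OF z, of star] by (simp add: star_mult m_assoc)
  have "star y \<otimes> a = star y \<otimes> (a \<otimes> star a \<otimes> y)" by (simp flip: y)
  also have "\<dots> = star a \<otimes> y" by (subst (2) sy) (simp add: m_assoc)
  finally have ya: "star y \<otimes> a = star a \<otimes> y" .
  have "a \<otimes> star z = (z \<otimes> star a \<otimes> a) \<otimes> star z" by (simp flip: z)
  also have "\<dots> = z \<otimes> star a" by (subst (2) sz) (simp add: m_assoc)
  finally have az: "a \<otimes> star z = z \<otimes> star a" .
  have aya: "a \<otimes> (star y \<otimes> a) = a" unfolding ya by (simp add: m_assoc[symmetric] flip: y)
  have aza: "a \<otimes> star z \<otimes> a = a" unfolding az by (simp flip: z)
  define m where "m = star y \<otimes> a \<otimes> star z"
  have [simp]: "m \<in> carrier G" by (simp add: m_def)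
  have am: "a \<otimes> m = a \<otimes> star z"
  proof -
    have "a \<otimes> m = (a \<otimes> (star y \<otimes> a)) \<otimes> star z" by (simp add: m_def m_assoc)
    then show ?thesis by (simp only: aya)
  qed
  have ma: "m \<otimes> a = star y \<otimes> a"
  proof -
    have "m \<otimes> a = star y \<otimes> (a \<otimes> star z \<otimes> a)" by (simp add: m_def m_assoc)
    then show ?thesis by (simp only: aza)
  qed
  have "m \<otimes> a \<otimes> m = star y \<otimes> (a \<otimes> m)" unfolding ma by (simp add: m_assoc)
  also have "\<dots> = m" unfolding am by (simp add: m_def m_assoc)
  finally have "m \<otimes> a \<otimes> m = m" .
  moreover have "star (a \<otimes> m) = a \<otimes> m" unfolding am by (simp add: star_mult az)
  moreover have "star (m \<otimes> a) = m \<otimes> a" unfolding ma by (simp add: star_mult ya)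
  moreover have "a \<otimes> m \<otimes> a = a" by (simp only: am aza)
  ultimately show ?thesis by (intro bexI[of _ m]) auto
qed

text \<open>The products $ax$ and $ay$ are self-adjoint and each absorbs the other, so applying the
  involution to $ay\,ax = ax$ gives $ax = ay$; likewise $xa = ya$. Then $x = yax = y$.\<close>

lemma moore_penrose_inverse_unique:
  assumes [simp]: "a \<in> carrier G" "x \<in> carrier G" "y \<in> carrier G"
    and x: "a \<otimes> x \<otimes> a = a" "x \<otimes> a \<otimes> x = x" "star (a \<otimes> x) = a \<otimes> x" "star (x \<otimes> a) = x \<otimes> a"
    and y: "a \<otimes> y \<otimes> a = a" "y \<otimes> a \<otimes> y = y" "star (a \<otimes> y) = a \<otimes> y" "star (y \<otimes> a) = y \<otimes> a"
  shows "x = y"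
proof -
  have "a \<otimes> x = star (a \<otimes> y \<otimes> (a \<otimes> x))" using x(3) y(1) by (simp add: m_assoc[symmetric])
  also have "\<dots> = (a \<otimes> x \<otimes> a) \<otimes> y"
    by (subst star_mult) (simp_all add: x(3) y(3) m_assoc)
  finally have ax: "a \<otimes> x = a \<otimes> y" by (simp only: x(1))
  have "x \<otimes> a = star (x \<otimes> a \<otimes> (y \<otimes> a))" using x(4) y(1) by (simp add: m_assoc)
  also have "\<dots> = y \<otimes> (a \<otimes> x \<otimes> a)"
    by (subst star_mult) (simp_all add: x(4) y(4) m_assoc)
  finally have xa: "x \<otimes> a = y \<otimes> a" by (simp only: x(1))
  have "x = y \<otimes> (a \<otimes> x)" using x(2) xa by (simp add: m_assoc)
  also have "\<dots> = y" using y(2) ax by (simp add: m_assoc)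
  finally show ?thesis .
qed
end

section \<open>The Minkowski adjoint as an involution\<close>

lemma minkowski_adjoint_carrier [simp]:
  "A \<in> carrier_mat n n \<Longrightarrow> minkowski_adjoint A \<in> carrier_mat n n"
  by (auto simp: minkowski_adjoint_def minkowski_metric_def mat_adjoint_def)

definition minkowski_sign :: "nat \<Rightarrow> complex" where
  "minkowski_sign i = (if i = 0 then 1 else - 1)"

lemma minkowski_sign_square [simp]: "minkowski_sign i * minkowski_sign i = 1"
  and conjugate_minkowski_sign [simp]: "conjugate (minkowski_sign i) = minkowski_sign i"
  by (auto simp: minkowski_sign_def)

text \<open>Multiplication by the diagonal metric matrix on both sides changes only signs. With this formula
  the involution laws reduce to the fact that the signs square to one.\<close>

lemma minkowski_adjoint_index:
  assumes A: "A \<in> carrier_mat n n" and "i < n" "j < n"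
  shows "minkowski_adjoint A $$ (i, j) =
    minkowski_sign i * conjugate (A $$ (j, i)) * minkowski_sign j"
proof -
  let ?G = "minkowski_metric n"
  have G: "?G \<in> carrier_mat n n" by (simp add: minkowski_metric_def)
  have H: "mat_adjoint A \<in> carrier_mat n n" using A by (auto simp: mat_adjoint_def)
  have G_index: "?G $$ (i, j) = (if i = j then minkowski_sign i else 0)" if "i < n" "j < n" for i j
    using that by (simp add: minkowski_metric_def minkowski_sign_def)
  have H_index: "mat_adjoint A $$ (i, j) = conjugate (A $$ (j, i))" if "i < n" "j < n" for i j
    using that A by (simp add: mat_adjoint_def mat_of_rows_def cols_def)
  have GH: "(?G * mat_adjoint A) $$ (i, l) = minkowski_sign i * conjugate (A $$ (l, i))" if "l < n" for l
  proof -
    have "(?G * mat_adjoint A) $$ (i, l) = (\<Sum>m\<in>{0..<n}. ?G $$ (i, m) * mat_adjoint A $$ (m, l))"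
      using G H assms that by (simp add: scalar_prod_def)
    also have "\<dots> = (\<Sum>m\<in>{0..<n}. if m = i then minkowski_sign i * conjugate (A $$ (l, i)) else 0)"
      by (rule sum.cong) (use assms that in \<open>auto simp: G_index H_index\<close>)
    finally show ?thesis using assms by simp
  qed
  have "minkowski_adjoint A $$ (i, j) = (\<Sum>l\<in>{0..<n}. (?G * mat_adjoint A) $$ (i, l) * ?G $$ (l, j))"
  proof -
    have "(M * ?G) $$ (i, j) = (\<Sum>l\<in>{0..<n}. M $$ (i, l) * ?G $$ (l, j))" if "M \<in> carrier_mat n n" for M
      using that G assms by (simp add: scalar_prod_def)
    from this[OF mult_carrier_mat[OF G H]] show ?thesis
      unfolding minkowski_adjoint_def carrier_matD(1)[OF A] .
  qed
  also have "\<dots> = (\<Sum>l\<in>{0..<n}. if l = j then minkowski_sign i * conjugate (A $$ (j, i)) * minkowski_sign j else 0)"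
    by (rule sum.cong) (use assms in \<open>auto simp: G_index GH\<close>)
  finally show ?thesis using assms by simp
qed

lemma minkowski_adjoint_mult:
  assumes A: "A \<in> carrier_mat n n" and B: "B \<in> carrier_mat n n"
  shows "minkowski_adjoint (A * B) = minkowski_adjoint B * minkowski_adjoint A"
proof (rule eq_matI)
  have cs: "minkowski_adjoint A \<in> carrier_mat n n" "minkowski_adjoint B \<in> carrier_mat n n"
    "minkowski_adjoint (A * B) \<in> carrier_mat n n" using A B by auto
  show "dim_row (minkowski_adjoint (A * B)) = dim_row (minkowski_adjoint B * minkowski_adjoint A)"
    "dim_col (minkowski_adjoint (A * B)) = dim_col (minkowski_adjoint B * minkowski_adjoint A)"
    using cs by auto
  fix i j
  assume "i < dim_row (minkowski_adjoint B * minkowski_adjoint A)"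
    "j < dim_col (minkowski_adjoint B * minkowski_adjoint A)"
  then have ij: "i < n" "j < n" using cs by auto
  have "(minkowski_adjoint B * minkowski_adjoint A) $$ (i, j) =
      (\<Sum>l\<in>{0..<n}. minkowski_adjoint B $$ (i, l) * minkowski_adjoint A $$ (l, j))"
    using cs ij by (simp add: scalar_prod_def)
  also have "\<dots> = (\<Sum>l\<in>{0..<n}. minkowski_sign i *
      conjugate (A $$ (j, l) * B $$ (l, i)) * minkowski_sign j)"
  proof (rule sum.cong)
    fix l assume "l \<in> {0..<n}"
    then have "minkowski_adjoint B $$ (i, l) * minkowski_adjoint A $$ (l, j) =
      (minkowski_sign l * minkowski_sign l) *
        (minkowski_sign i * conjugate (B $$ (l, i)) * conjugate (A $$ (j, l)) * minkowski_sign j)"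
      using ij by (simp only: minkowski_adjoint_index[OF A] minkowski_adjoint_index[OF B] atLeastLessThan_iff mult_ac)
    then show "minkowski_adjoint B $$ (i, l) * minkowski_adjoint A $$ (l, j) =
      minkowski_sign i * conjugate (A $$ (j, l) * B $$ (l, i)) * minkowski_sign j"
      by (simp add: conjugate_dist_mul mult_ac)
  qed simp
  also have "\<dots> = minkowski_sign i * conjugate ((A * B) $$ (j, i)) * minkowski_sign j"
    using A B ij by (simp add: scalar_prod_def sum_conjugate sum_distrib_left sum_distrib_right)
  finally show "minkowski_adjoint (A * B) $$ (i, j) = (minkowski_adjoint B * minkowski_adjoint A) $$ (i, j)"
    using minkowski_adjoint_index[of "A * B" n i j] A B ij by simp
qed

lemma minkowski_adjoint_adjoint:
  assumes A: "A \<in> carrier_mat n n"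
  shows "minkowski_adjoint (minkowski_adjoint A) = A"
proof (rule eq_matI)
  fix i j assume "i < dim_row A" "j < dim_col A"
  then have ij: "i < n" "j < n" using A by auto
  have "minkowski_adjoint (minkowski_adjoint A) $$ (i, j) =
    (minkowski_sign i * minkowski_sign i) * (minkowski_sign j * minkowski_sign j) * A $$ (i, j)"
    using ij minkowski_adjoint_index[OF minkowski_adjoint_carrier[OF A] ij]
      minkowski_adjoint_index[OF A ij(2,1)]
    by (simp only: conjugate_dist_mul conjugate_id conjugate_minkowski_sign mult_ac)
  then show "minkowski_adjoint (minkowski_adjoint A) $$ (i, j) = A $$ (i, j)" by simp
qed (use carrier_matD[OF minkowski_adjoint_carrier[OF minkowski_adjoint_carrier[OF A]]] A in simp_all)

lemma involutive_monoid_minkowski: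
  "involutive_monoid (ring_mat TYPE(complex) n ()) minkowski_adjoint"
proof -
  interpret ring "ring_mat TYPE(complex) n ()" by (rule ring_mat)
  show ?thesis
    by unfold_locales
      (auto simp: ring_mat_simps minkowski_adjoint_mult minkowski_adjoint_adjoint)
qed

text \<open>The ranks satisfy $\mathrm{rk}(A^\sim AA^\sim) \le \mathrm{rk}(AA^\sim) \le \mathrm{rk}(A)$, so the
  hypothesis makes all three equal. The second equality recovers $A = AA^\sim Y$, the first
  $AA^\sim = ZA^\sim AA^\sim$; together they give
  $A = AA^\sim Y = ZA^\sim(AA^\sim Y) = ZA^\sim A$.\<close>

lemma ex1_minkowski_inverse:
  assumes A: "A \<in> carrier_mat n n"
    and rank: "mat_rank (minkowski_adjoint A * A * minkowski_adjoint A) = mat_rank A"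
  shows "\<exists>!X. is_minkowski_inverse A X"
proof -
  interpret involutive_monoid "ring_mat TYPE(complex) n ()" minkowski_adjoint
    by (rule involutive_monoid_minkowski)
  let ?S = "minkowski_adjoint A"
  have S: "?S \<in> carrier_mat n n" using A by simp
  have AS: "A * ?S \<in> carrier_mat n n" using A S by simp
  have "vec_space.rank n (?S * (A * ?S)) = vec_space.rank n A"
    using rank A S carrier_matD(1)[OF S] by (simp add: mat_rank_def assoc_mult_mat[of _ n n _ n _ n])
  then have rk: "vec_space.rank n (A * ?S) = vec_space.rank n A"
    "vec_space.rank n (?S * (A * ?S)) = vec_space.rank n (A * ?S)"
    using rank_mult_le_left[OF A S] rank_mult_le_right[OF S AS] by auto
  obtain Y where Y: "Y \<in> carrier_mat n n" "A = A * ?S * Y"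
    using left_factor_recoverable[OF A S rk(1)] .
  obtain Z where Z: "Z \<in> carrier_mat n n" "A * ?S = Z * (?S * (A * ?S))"
    using right_factor_recoverable[OF S AS rk(2)] .
  note Y(2)
  also have "A * ?S * Y = Z * (?S * (A * ?S)) * Y" by (rule arg_cong[OF Z(2)])
  also have "\<dots> = Z * ?S * (A * ?S * Y)"
    using A S Y(1) Z(1) by (simp add: assoc_mult_mat[of _ n n _ n _ n] mult_carrier_mat[of _ n n _ n])
  also have "\<dots> = Z * ?S * A" by (simp only: Y(2)[symmetric])
  finally have "A = Z * ?S * A" .
  from moore_penrose_inverse_exists[unfolded ring_mat_simps, OF A Y(1) Z(1) Y(2) this]
  have "\<exists>X. is_minkowski_inverse A X"
    unfolding is_minkowski_inverse_def carrier_matD(1)[OF A] by blast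
  moreover have "X = X'" if "is_minkowski_inverse A X" "is_minkowski_inverse A X'" for X X'
    using moore_penrose_inverse_unique[of A X X'] that A
    by (auto simp: is_minkowski_inverse_def ring_mat_simps)
  ultimately show ?thesis by blast
qed

section \<open>Existence and uniqueness of the Drazin inverse of a matrix\<close>

text \<open>The index is attained: the rank of $A^k$ is least for some $k$, and there it cannot drop any
  further.\<close>

lemma mat_index_rank:
  assumes A: "A \<in> carrier_mat n n"
  shows "mat_rank (A ^\<^sub>m (mat_index A + 1)) = mat_rank (A ^\<^sub>m mat_index A)"
proof -
  define f where "f k = mat_rank (A ^\<^sub>m k)" for k
  obtain k where k: "\<And>j. f k \<le> f j" using ex_has_least_nat[of "\<lambda>_. True" 0 f] by auto
  have "f (k + 1) \<le> f k"
    using rank_mult_le_left[OF pow_carrier_mat[OF A] A] A by (simp add: f_def mat_rank_def)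
  with k[of "k + 1"] have "f (k + 1) = f k" by simp
  then show ?thesis unfolding mat_index_def f_def by (rule LeastI)
qed

text \<open>With $k$ the index, equal ranks of $A^{k+1}$ and $A^k$ allow $A^k$ to be recovered from
  $A^{k+1} = A^k A$ as left factor and from $A^{k+1} = A A^k$ as right factor.\<close>

lemma ex1_drazin_inverse:
  assumes A: "A \<in> carrier_mat n n"
  shows "\<exists>!X. is_drazin_inverse A X"
proof -
  interpret ring "ring_mat TYPE(complex) n ()" by (rule ring_mat)
  note pow = pow_mat_ring_pow[OF A, of _ "()"]
  let ?k = "mat_index A"
  have P: "A ^\<^sub>m ?k \<in> carrier_mat n n" using A by simp
  have Suc: "A ^\<^sub>m (?k + 1) = A ^\<^sub>m ?k * A" by simp
  have Suc2: "A ^\<^sub>m (?k + 1) = A * A ^\<^sub>m ?k"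
    using nat_pow_Suc2[of A ?k] A by (simp add: pow ring_mat_simps)
  have rk: "vec_space.rank n (A ^\<^sub>m (?k + 1)) = vec_space.rank n (A ^\<^sub>m ?k)"
    using mat_index_rank[OF A] A by (simp add: mat_rank_def)
  obtain Y where Y: "Y \<in> carrier_mat n n" "A ^\<^sub>m ?k = A ^\<^sub>m (?k + 1) * Y"
    using left_factor_recoverable[OF P A] rk unfolding Suc by metis
  obtain Z where Z: "Z \<in> carrier_mat n n" "A ^\<^sub>m ?k = Z * A ^\<^sub>m (?k + 1)"
    using right_factor_recoverable[OF A P] rk unfolding Suc2 by metis
  have "\<exists>X. is_drazin_inverse A X"
    using drazin_inverse_exists[unfolded ring_mat_simps, OF A Y(1) Z(1), folded pow, OF Y(2) Z(2)]
    unfolding is_drazin_inverse_def carrier_matD(1)[OF A] by blast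
  moreover have "X = X'" if "is_drazin_inverse A X" "is_drazin_inverse A X'" for X X'
    using drazin_inverse_unique[of A X X' ?k] that A
    by (auto simp: is_drazin_inverse_def ring_mat_simps pow simp del: nat_pow_Suc)
  ultimately show ?thesis by blast
qed

section \<open>The system of matrix equations\<close>

theorem theorem3p1:
  fixes A :: "complex mat" and n k :: nat
  assumes "n > 0"
    and "A \<in> carrier_mat n n"
    and "mat_index A = k"
    and "mat_rank (minkowski_adjoint A * A * minkowski_adjoint A) = mat_rank A"
  shows "{X \<in> carrier_mat n n.
            X * A * X = X \<and>
            X * A = drazin_inverse A * A \<and>
            A ^\<^sub>m k * X = A ^\<^sub>m k * minkowski_inverse A}
         = {drazin_inverse A * A * minkowski_inverse A}"
proof -
  let ?D = "drazin_inverse A" and ?M = "minkowski_inverse A"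
  note A = assms(2) and k = assms(3)
  interpret ring "ring_mat TYPE(complex) n ()" by (rule ring_mat)
  note pow = pow_mat_ring_pow[OF A, of _ "()"]
  note assoc = assoc_mult_mat[of _ n n _ n _ n]
  have "is_drazin_inverse A ?D"
    unfolding drazin_inverse_def by (rule theI'[OF ex1_drazin_inverse[OF A]])
  then have D: "?D \<in> carrier_mat n n" and DAD: "?D * A * ?D = ?D" and AD: "A * ?D = ?D * A"
    and AkD: "A ^\<^sub>m (k + 1) * ?D = A ^\<^sub>m k"
    using A k by (auto simp: is_drazin_inverse_def)
  have "is_minkowski_inverse A ?M"
    unfolding minkowski_inverse_def by (rule theI'[OF ex1_minkowski_inverse[OF A assms(4)]])
  then have M: "?M \<in> carrier_mat n n" and AMA: "A * ?M * A = A"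
    using A by (auto simp: is_minkowski_inverse_def)
  have Ak: "A ^\<^sub>m k \<in> carrier_mat n n" using A by simp
  \<comment> \<open>The matrix through which \<open>A ^\<^sub>m k * X\<close> determines \<open>?D * X\<close>.\<close>
  define E where "E = ?D ^\<^sub>m (k + 1)"
  have E: "E \<in> carrier_mat n n" unfolding E_def using D by (rule pow_carrier_mat)
  have EAk: "E * A ^\<^sub>m k = ?D"
    using commuting_outer_inverse_power(1)[of A ?D k] A D DAD AD
    by (simp add: E_def pow pow_mat_ring_pow[OF D, of _ "()"] ring_mat_simps del: nat_pow_Suc)
  show ?thesis
  proof (intro Set.set_eqI iffI)
    fix X assume "X \<in> {X \<in> carrier_mat n n. X * A * X = X \<and> X * A = ?D * A \<and>
      A ^\<^sub>m k * X = A ^\<^sub>m k * ?M}"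
    then have X: "X \<in> carrier_mat n n" and XAX: "X * A * X = X" and XA: "X * A = ?D * A"
      and AkX: "A ^\<^sub>m k * X = A ^\<^sub>m k * ?M" by auto
    have "?D * X = ?D * ?M"
    proof -
      have "?D * X = E * (A ^\<^sub>m k * X)" using E Ak X by (simp add: EAk flip: assoc)
      also have "\<dots> = ?D * ?M" using E Ak M by (simp add: AkX EAk flip: assoc)
      finally show ?thesis .
    qed
    moreover have "?D * A * Y = A * (?D * Y)" if "Y \<in> carrier_mat n n" for Y
      unfolding AD[symmetric] by (rule assoc_mult_mat[OF A D that])
    ultimately have "?D * A * X = ?D * A * ?M" using X M by simp
    then show "X \<in> {?D * A * ?M}" using XAX XA by simp
  next
    fix X assume "X \<in> {?D * A * ?M}"
    then have X: "X = ?D * A * ?M" by simp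
    have XA: "X * A = ?D * A"
    proof -
      have "X * A = ?D * (A * ?M * A)" unfolding X using A D M by (simp add: assoc)
      then show ?thesis by (simp only: AMA)
    qed
    have "X * A * X = (?D * A * ?D) * (A * ?M)"
      unfolding XA unfolding X using A D M by (simp add: assoc)
    also have "\<dots> = X" unfolding DAD X using A D M by (simp add: assoc)
    finally have XAX: "X * A * X = X" .
    have "A ^\<^sub>m k * X = A ^\<^sub>m k * (A * ?D) * ?M"
      unfolding X AD using A D M Ak by (simp add: assoc)
    also have "A ^\<^sub>m k * (A * ?D) = A ^\<^sub>m (k + 1) * ?D"
      using A D Ak by (simp add: assoc)
    finally have "A ^\<^sub>m k * X = A ^\<^sub>m k * ?M" by (simp only: AkD)
    moreover have "X \<in> carrier_mat n n" unfolding X using A D M by simp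
    ultimately show "X \<in> {X \<in> carrier_mat n n. X * A * X = X \<and> X * A = ?D * A \<and>
      A ^\<^sub>m k * X = A ^\<^sub>m k * ?M}" using XAX XA by simp
  qed
qed

end
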